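(* Let $(a_i)$ be a representing sequence with $a_1=k$, and let $w$ be its representation word; assume $w$ is strongly Fergusonian. Let $T=\{a_i-1\mid i\geq2\}\cup\{1,\dots,k-1\}$, let $N$ be the set of non-volatile zends with respect to $(a_i)$, and let $L=\mathbb{N}\setminus N$ (with $\mathbb N=\{0,1,2,\dots\}$). Let $I$ be a set of positive integers with $T\subseteq I$ and $(N+I)\cap N=\emptyset$. Then: (1) for every set $S$ with $T\subseteq S\subseteq I$, $w$ is the Nim sequence of $S$; (2) for every such $S$ and every $i$, writing $S_i=\{s\in S\mid s<a_i\}$: if $a+a_i-S_i\subseteq L$ for all $a\in N$ with $a<a_i$, then $\big(w[0..a_i)\big)^\omega$ is the Nim sequence of $S_i$.
   Context: A representing sequence is a strictly increasing sequence $(a_i)_{i\ge0}$ of positive integers with $a_0=1$. For $n\ge1$ with $a_j\le n<a_{j+1}$, the $(a_i)$-representation of $n$ is the digit string $d_j\cdots d_0$ with $n=\sum d_ia_i$ and $\sum d_i$ minimal (greedy); the representation of $0$ is the single digit $0$. $n$ is a zend if its representation ends in $0$. For a positive integer $m$, $n\ge0$ is $m$-volatile if the representation of $n+1$ ends in at least $m$ zeros; volatile means $1$-volatile; non-volatile means the representation of $n+1$ does not end in $0$. The representation word of $(a_i)$ is the word $w$ over $\{0,\dots,a_1\}$ with $w[n]=a_1$ if $n$ is $2$-volatile, and otherwise $w[n]$ is the last digit of the representation of $n$. A word over $\{0,1,\dots,k\}$ ($k\ge2$) is Fergusonian if for every $0\le i<k-1$ every occurrence of $i$ is immediately followed by $i+1$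 and every occurrence of $i+1$ is immediately preceded by $i$; it is strongly Fergusonian if moreover it has no two consecutive $k$'s. For sets $A,B$ and integer $n$: $A+B=\{a+b\}$, $n-A=\{n-a\}$, $A+n=\{a+n\}$, etc. Words are indexed from $0$; $w[a..b)$ is the factor from position $a$ to $b-1$; $u^\omega$ is the infinite repetition of $u$. For a set $S$ of positive integers, $\mathrm{SG}_S(n)=\mathrm{mex}\{\mathrm{SG}_S(n-s)\mid s\in S,s\le n\}$ and the Nim sequence of $S$ is $(\mathrm{SG}_S(n))_{n\ge0}$. *)

theory Defs
  imports Main "HOL-Library.Set_Algebras"
begin

subsection \<open>Representations of natural numbers\<close>

definition representing_sequence :: "(nat \<Rightarrow> nat) \<Rightarrow> bool" where
  "representing_sequence a \<longleftrightarrow> strict_mono a \<and> (\<forall>i. 0 < a i) \<and> a 0 = 1"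

text \<open>
  Digit strings are lists with the most significant digit first.  The string
  \<open>d\<^sub>j \<dots> d\<^sub>0\<close> is the greedy one: each digit is the largest possible, given the digits
  to its left.  Minimality of the digit sum alone does not determine a string
  (for \<open>1, 2, 3, 5, \<dots>\<close> one has \<open>4 = 3 + 1 = 2 + 2\<close>).
\<close>

primrec greedy_digits :: "(nat \<Rightarrow> nat) \<Rightarrow> nat \<Rightarrow> nat \<Rightarrow> nat list" where
  "greedy_digits a 0 n = [n div a 0]"
| "greedy_digits a (Suc j) n = (n div a (Suc j)) # greedy_digits a j (n mod a (Suc j))"

text \<open>For \<open>n \<ge> 1\<close> the leading position is the \<open>j\<close> with \<open>a j \<le> n < a (j + 1)\<close>.\<close>

definition representation :: "(nat \<Rightarrow> nat) \<Rightarrow> nat \<Rightarrow> nat list" where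
  "representation a n =
     (if n = 0 then [0] else greedy_digits a (THE j. a j \<le> n \<and> n < a (Suc j)) n)"

definition ends_in_zeros :: "nat \<Rightarrow> nat list \<Rightarrow> bool" where
  "ends_in_zeros m ds \<longleftrightarrow> (\<exists>us. ds = us @ replicate m 0)"

definition zend :: "(nat \<Rightarrow> nat) \<Rightarrow> nat \<Rightarrow> bool" where
  "zend a n \<longleftrightarrow> ends_in_zeros 1 (representation a n)"

definition m_volatile :: "(nat \<Rightarrow> nat) \<Rightarrow> nat \<Rightarrow> nat \<Rightarrow> bool" where
  "m_volatile a m n \<longleftrightarrow> ends_in_zeros m (representation a (n + 1))"

definition volatile :: "(nat \<Rightarrow> nat) \<Rightarrow> nat \<Rightarrow> bool" where
  "volatile a n \<longleftrightarrow> m_volatile a 1 n"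


subsection \<open>Infinite words over the natural numbers\<close>

type_synonym word = "nat \<Rightarrow> nat"

definition representation_word :: "(nat \<Rightarrow> nat) \<Rightarrow> word" where
  "representation_word a n =
     (if m_volatile a 2 n then a 1 else last (representation a n))"

definition fergusonian :: "nat \<Rightarrow> word \<Rightarrow> bool" where
  "fergusonian k w \<longleftrightarrow>
     k \<ge> 2 \<and> range w \<subseteq> {0..k} \<and>
     (\<forall>i < k - 1.
        (\<forall>n. w n = i \<longrightarrow> w (n + 1) = i + 1) \<and>
        (\<forall>n. w n = i + 1 \<longrightarrow> n \<ge> 1 \<and> w (n - 1) = i))"

definition strongly_fergusonian :: "nat \<Rightarrow> word \<Rightarrow> bool" where
  "strongly_fergusonian k w \<longleftrightarrow>
     fergusonian k w \<and> \<not> (\<exists>n. w n = k \<and> w (n + 1) = k)"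

text \<open>\<open>factor w b c\<close> is \<open>w[b..c)\<close> and \<open>omega_power u\<close> is the infinite repetition of \<open>u\<close>.\<close>

definition factor :: "word \<Rightarrow> nat \<Rightarrow> nat \<Rightarrow> nat list" where
  "factor w b c = map w [b..<c]"

definition omega_power :: "nat list \<Rightarrow> word" where
  "omega_power u n = u ! (n mod length u)"


subsection \<open>Subtraction games\<close>

definition mex :: "nat set \<Rightarrow> nat" where
  "mex A = (LEAST m. m \<notin> A)"

text \<open>
  The guard \<open>0 < s\<close> only serves to make the recursion terminate for arbitrary \<open>S\<close>;
  it is vacuous for sets of positive integers.
\<close>

function SG :: "nat set \<Rightarrow> nat \<Rightarrow> nat" where
  "SG S n = mex ((\<lambda>s. SG S (n - s)) ` {s \<in> S. 0 < s \<and> s \<le> n})"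
  by auto
termination
  by (relation "measure snd") auto

declare SG.simps [simp del]

definition is_nim_sequence :: "word \<Rightarrow> nat set \<Rightarrow> bool" where
  "is_nim_sequence u S \<longleftrightarrow> (\<forall>n. u n = SG S n)"


subsection \<open>Basic facts\<close>

lemma representing_sequence_bracket:
  assumes "representing_sequence a" "1 \<le> n"
  shows "\<exists>!j. a j \<le> n \<and> n < a (Suc j)"
proof -
  have sm: "strict_mono a" and a0: "a 0 = 1"
    using assms(1) by (auto simp: representing_sequence_def)
  have ge: "i \<le> a i" for i
    using strict_mono_imp_increasing[OF sm] by simp
  define j where "j = (LEAST j. n < a (Suc j))"
  have ex: "n < a (Suc n)"
    using ge[of "Suc n"] by simp
  have up: "n < a (Suc j)"
    unfolding j_def by (rule LeastI[of "\<lambda>j. n < a (Suc j)", OF ex])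
  have low: "a j \<le> n"
  proof (cases j)
    case 0
    then show ?thesis using a0 assms(2) by simp
  next
    case (Suc i)
    then have "\<not> n < a (Suc i)"
      using not_less_Least[of i "\<lambda>j. n < a (Suc j)"] unfolding j_def by simp
    then show ?thesis using Suc by simp
  qed
  show ?thesis
  proof (rule ex1I[of _ j])
    show "a j \<le> n \<and> n < a (Suc j)" using low up by simp
    fix l assume l: "a l \<le> n \<and> n < a (Suc l)"
    have "a l < a (Suc j)" "a j < a (Suc l)" using l low up by auto
    then show "l = j" by (simp add: strict_mono_less[OF sm])
  qed
qed

lemma length_greedy_digits: "length (greedy_digits a j n) = Suc j"
  by (induction j arbitrary: n) simp_all

lemma greedy_digits_value:
  assumes "a 0 = 1"
  shows "(\<Sum>i\<le>j. rev (greedy_digits a j n) ! i * a i) = n"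
proof (induction j arbitrary: n)
  case 0
  then show ?case using assms by simp
next
  case (Suc j)
  have "(\<Sum>i\<le>j. rev (greedy_digits a (Suc j) n) ! i * a i)
      = (\<Sum>i\<le>j. rev (greedy_digits a j (n mod a (Suc j))) ! i * a i)"
    by (rule sum.cong) (simp_all add: nth_append length_greedy_digits)
  also have "\<dots> = n mod a (Suc j)" by (rule Suc.IH)
  finally show ?case
    by (simp add: nth_append length_greedy_digits)
qed

end

theory Submission
  imports Defs
begin

text \<open>
  A zero of \<open>w\<close> is a non-volatile zend, and \<open>w\<close> is a concatenation of blocks of the form
  \<open>0 1 \<dots> l\<close>.  If two positions at a distance \<open>s \<in> I\<close> carried the same letter, then shifting both
  to the starts of their blocks would give two zeros of \<open>w\<close> at distance \<open>s\<close>, which is excluded.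
  Conversely, every letter smaller than \<open>w[n]\<close> occurs earlier in the block of \<open>n\<close>, at a distance in
  \<open>{1..k-1}\<close>, except for the letter \<open>0\<close> when \<open>w[n] = k\<close>.  In that case \<open>n\<close> is \<open>2\<close>-volatile, so
  the least term \<open>a\<^sub>j\<close> occurring in the representation of \<open>n + 1\<close> has \<open>j \<ge> 2\<close>, and
  \<open>n - (a\<^sub>j - 1)\<close> is a non-volatile zend.
  Hence \<open>w\<close> satisfies the mex recursion.  If \<open>n < a\<^sub>i\<close>, then all these occurrences of smaller
  letters lie in \<open>w[0..a\<^sub>i)\<close>, so they survive in its infinite repetition; the hypothesis on \<open>S\<^sub>i\<close>
  excludes zeros at a distance in \<open>S\<^sub>i\<close> across the border of two periods.
\<close>

lemma diff_mod_eq: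
  fixes m n p :: nat
  assumes "m \<le> n mod p"
  shows "(n - m) mod p = n mod p - m"
proof (cases "p = 0")
  case False
  have "n - m = (n mod p - m) + n div p * p"
    using assms div_mult_mod_eq[of n p] by linarith
  moreover have "n mod p - m < p"
    using False by (simp add: less_imp_diff_less)
  ultimately show ?thesis by simp
qed simp

lemma set_plus_Int_empty_iff:
  "(A + B) \<inter> C = {} \<longleftrightarrow> (\<forall>x\<in>A. \<forall>y\<in>B. x + y \<notin> C)"
  by (auto simp: set_plus_def)

section \<open>Trailing zeros\<close>

lemma ends_in_zeros_antimono:
  assumes "ends_in_zeros m ds" "l \<le> m"
  shows "ends_in_zeros l ds"
proof -
  obtain us where "ds = us @ replicate m 0"
    using assms(1) by (auto simp: ends_in_zeros_def)
  also have "\<dots> = (us @ replicate (m - l) 0) @ replicate l 0"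
    using assms(2) by (simp flip: replicate_add)
  finally show ?thesis by (auto simp: ends_in_zeros_def)
qed

lemma ends_in_zeros_le_length: "ends_in_zeros m ds \<Longrightarrow> m \<le> length ds"
  by (auto simp: ends_in_zeros_def)

lemma ends_in_zeros_1_iff: "ds \<noteq> [] \<Longrightarrow> ends_in_zeros 1 ds \<longleftrightarrow> last ds = 0"
  by (cases ds rule: rev_cases) (auto simp: ends_in_zeros_def)

lemma ends_in_zeros_Cons:
  "ends_in_zeros m (d # ds) \<longleftrightarrow> ends_in_zeros m ds \<or> d # ds = replicate m 0"
  by (auto simp: ends_in_zeros_def Cons_eq_append_conv)

lemma greedy_digits_nonempty [simp]: "greedy_digits a j n \<noteq> []"
  by (cases j) simp_all

lemma representation_nonempty: "representation a n \<noteq> []"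
  by (simp add: representation_def)

lemma last_representation_0: "last (representation a 0) = 0"
  by (simp add: representation_def)

lemma zend_iff: "zend a n \<longleftrightarrow> last (representation a n) = 0"
  unfolding zend_def by (rule ends_in_zeros_1_iff[OF representation_nonempty])

lemma volatile_iff: "volatile a n \<longleftrightarrow> last (representation a (n + 1)) = 0"
  unfolding volatile_def m_volatile_def by (rule ends_in_zeros_1_iff[OF representation_nonempty])

lemma volatile_if_m_volatile: "m_volatile a m n \<Longrightarrow> 1 \<le> m \<Longrightarrow> volatile a n"
  unfolding volatile_def m_volatile_def by (rule ends_in_zeros_antimono)

section \<open>Greedy representations\<close>

lemma last_greedy_digits_Suc:
  "last (greedy_digits a (Suc j) n) = last (greedy_digits a j (n mod a (Suc j)))"
  by simp

lemma last_greedy_digits_0 [simp]: "last (greedy_digits a j 0) = 0"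
  by (induction j) (simp_all add: last_greedy_digits_Suc del: greedy_digits.simps(2))

context
  fixes a :: "nat \<Rightarrow> nat"
  assumes rep: "representing_sequence a"
begin

lemma representing_sequence_0: "a 0 = 1"
  using rep by (simp add: representing_sequence_def)

lemma representing_sequence_le_iff: "a i \<le> a j \<longleftrightarrow> i \<le> j"
  using rep by (simp add: representing_sequence_def strict_mono_less_eq)

lemma representing_sequence_gt_1: "0 < i \<Longrightarrow> 1 < a i"
  using rep strict_monoD[of a 0 i] by (simp add: representing_sequence_def)

lemma greedy_digits_eq_zeros_imp_0: "greedy_digits a j n = replicate l 0 \<Longrightarrow> n = 0"
proof (induction j arbitrary: n l)
  case 0
  then show ?case by (cases l) (simp_all add: representing_sequence_0)
next
  case (Suc j)
  then have "n div a (Suc j) = 0" "n mod a (Suc j) = 0" by (cases l; simp)+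
  then show ?case using div_mult_mod_eq[of n "a (Suc j)"] by simp
qed

lemma last_greedy_digits_leading_zeros:
  assumes "n < a (Suc j)" "j \<le> l"
  shows "last (greedy_digits a l n) = last (greedy_digits a j n)"
  using assms(2)
proof (induction l rule: dec_induct)
  case (step l)
  have "a (Suc j) \<le> a (Suc l)"
    using step.hyps by (simp add: representing_sequence_le_iff)
  then have "n mod a (Suc l) = n" using assms(1) by simp
  then show ?case using step.IH by (simp only: last_greedy_digits_Suc)
qed simp

lemma representation_eq_greedy_digits:
  assumes "0 < n"
  obtains j where "a j \<le> n" "n < a (Suc j)" "representation a n = greedy_digits a j n"
proof
  let ?j = "THE j. a j \<le> n \<and> n < a (Suc j)"
  have "a ?j \<le> n \<and> n < a (Suc ?j)"
    by (rule theI'[OF representing_sequence_bracket[OF rep]]) (use assms in simp)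
  then show "a ?j \<le> n" "n < a (Suc ?j)" by simp_all
  show "representation a n = greedy_digits a ?j n"
    using assms by (simp add: representation_def)
qed

lemma last_representation:
  assumes "n < a (Suc j)"
  shows "last (representation a n) = last (greedy_digits a j n)"
proof (cases "n = 0")
  case True
  then show ?thesis by (simp add: representation_def)
next
  case False
  then have "0 < n" by simp
  then obtain l where l: "a l \<le> n" "n < a (Suc l)" "representation a n = greedy_digits a l n"
    using representation_eq_greedy_digits by blast
  have "\<not> a (Suc j) \<le> a l" using l(1) assms by simp
  then have "l \<le> j" by (simp add: representing_sequence_le_iff)
  from last_greedy_digits_leading_zeros[OF l(2) this] show ?thesis by (simp add: l(3))
qed

lemma last_representation_1: "last (representation a 1) = 1"
  using last_representation[of 1 0] representing_sequence_gt_1[of 1]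
  by (simp add: representing_sequence_0)

lemma last_representation_less: "last (representation a n) < a 1"
proof -
  have "n < a (Suc (Suc n))"
    using rep strict_mono_imp_increasing[of a "Suc (Suc n)"]
    by (simp add: representing_sequence_def)
  then have "last (representation a n) = last (greedy_digits a (Suc n) n)"
    by (rule last_representation)
  also have "last (greedy_digits a (Suc j) m) < a 1" for j m
  proof (induction j arbitrary: m)
    case 0
    show ?case using representing_sequence_gt_1[of 1] by (simp add: representing_sequence_0)
  qed (simp only: last_greedy_digits_Suc)
  finally show ?thesis .
qed

lemma ends_in_zeros_greedy_digits_mod:
  assumes "ends_in_zeros r (greedy_digits a (Suc j) n)" "0 < n"
  shows "ends_in_zeros r (greedy_digits a j (n mod a (Suc j)))"
  using assms greedy_digits_eq_zeros_imp_0[of "Suc j" n r] by (auto simp: ends_in_zeros_Cons)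

text \<open>The witness \<open>i\<close> is the position of the last nonzero digit: lowering that digit by one leaves
  a greedy string, whose lower \<open>i\<close> digits can be replaced by those of any \<open>c < a i\<close>.\<close>

lemma last_greedy_digits_minus_least_term:
  assumes "ends_in_zeros r (greedy_digits a j n)" "1 \<le> r" "0 < n"
  shows "\<exists>i\<ge>r. a i \<le> n \<and>
    (\<forall>c<a i. last (greedy_digits a j (n - a i + c)) = last (greedy_digits a j c))"
  using assms(1,3)
proof (induction j arbitrary: n)
  case 0
  then have "ends_in_zeros 1 [n]"
    using ends_in_zeros_antimono[OF _ assms(2)] by (simp add: representing_sequence_0)
  then have "n = 0" using ends_in_zeros_1_iff[of "[n]"] by simp
  with 0 show ?case by simp
next
  case (Suc j)
  let ?A = "a (Suc j)"
  note trailing = ends_in_zeros_greedy_digits_mod[OF Suc.prems]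
  show ?case
  proof (cases "n mod ?A = 0")
    case True
    have "r \<le> Suc j"
      using ends_in_zeros_le_length[OF trailing] by (simp add: length_greedy_digits)
    moreover have le: "?A \<le> n"
      using True Suc.prems(2) by (simp add: dvd_imp_le mod_eq_0_iff_dvd)
    moreover have "(n - ?A + c) mod ?A = c mod ?A" for c
      using mod_add_left_eq[of "n - ?A" ?A c] le_mod_geq[OF le] True by simp
    ultimately show ?thesis
      by (intro exI[of _ "Suc j"]) (simp only: last_greedy_digits_Suc simp_thms)
  next
    case False
    then obtain i where i: "r \<le> i" "a i \<le> n mod ?A"
      "\<forall>c<a i. last (greedy_digits a j (n mod ?A - a i + c)) = last (greedy_digits a j c)"
      using Suc.IH[OF trailing] by blast
    have A: "n mod ?A < ?A" using representing_sequence_gt_1[of "Suc j"] by simp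
    have "last (greedy_digits a (Suc j) (n - a i + c)) = last (greedy_digits a (Suc j) c)"
      if c: "c < a i" for c
    proof -
      have "(n - a i + c) mod ?A = n mod ?A - a i + c"
        using diff_mod_eq[OF i(2)] mod_add_left_eq[of "n - a i" ?A c] i(2) c A by simp
      moreover have "c mod ?A = c" using c i(2) A by simp
      ultimately show ?thesis using i(3) c by (simp only: last_greedy_digits_Suc)
    qed
    moreover have "a i \<le> n" using i(2) mod_less_eq_dividend order_trans by blast
    ultimately show ?thesis using i(1) by blast
  qed
qed

lemma last_representation_minus_least_term:
  assumes "ends_in_zeros r (representation a n)" "1 \<le> r" "0 < n"
  obtains i where "r \<le> i" "a i \<le> n"
    "\<And>c. c < a i \<Longrightarrow> last (representation a (n - a i + c)) = last (representation a c)"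
proof -
  obtain j where j: "n < a (Suc j)" "representation a n = greedy_digits a j n"
    using representation_eq_greedy_digits[OF assms(3)] by blast
  then have "ends_in_zeros r (greedy_digits a j n)" using assms(1) by simp
  then obtain i where i: "r \<le> i" "a i \<le> n"
    "\<forall>c<a i. last (greedy_digits a j (n - a i + c)) = last (greedy_digits a j c)"
    using last_greedy_digits_minus_least_term[OF _ assms(2,3)] by metis
  show ?thesis
  proof (rule that[OF i(1,2)])
    fix c assume c: "c < a i"
    with i(2) j(1) have "n - a i + c < a (Suc j)" "c < a (Suc j)" by linarith+
    from this[THEN last_representation]
    show "last (representation a (n - a i + c)) = last (representation a c)"
      using i(3) c by simp
  qed
qed

end

section \<open>Non-volatile zends\<close>

definition nonvolatile_zends :: "(nat \<Rightarrow> nat) \<Rightarrow> nat set" where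
  "nonvolatile_zends a = {n. zend a n \<and> \<not> volatile a n}"

lemma nonvolatile_zends_iff:
  "n \<in> nonvolatile_zends a \<longleftrightarrow>
     last (representation a n) = 0 \<and> last (representation a (n + 1)) \<noteq> 0"
  by (simp add: nonvolatile_zends_def zend_iff volatile_iff)

lemma m_volatile_minus_term:
  assumes "representing_sequence a" "m_volatile a m n" "1 \<le> m"
  obtains i where "m \<le> i" "a i - 1 \<le> n" "n - (a i - 1) \<in> nonvolatile_zends a"
proof -
  have "ends_in_zeros m (representation a (n + 1))" "0 < n + 1"
    using assms(2) by (simp_all add: m_volatile_def)
  from last_representation_minus_least_term[OF assms(1) this(1) assms(3) this(2)]
  obtain i where i: "m \<le> i" "a i \<le> n + 1"
    "\<And>c. c < a i \<Longrightarrow> last (representation a (n + 1 - a i + c)) = last (representation a c)"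
    by metis
  have "1 < a i" using representing_sequence_gt_1[OF assms(1)] assms(3) i(1) by simp
  then have "n + 1 - a i \<in> nonvolatile_zends a"
    using i(3)[of 0] i(3)[of 1] last_representation_0 last_representation_1[OF assms(1)]
    by (simp add: nonvolatile_zends_iff)
  moreover have "n - (a i - 1) = n + 1 - a i" using \<open>1 < a i\<close> by simp
  ultimately show ?thesis using that[of i] i(1,2) by simp
qed

section \<open>Staircase words and Fergusonian words\<close>

abbreviation zeros :: "word \<Rightarrow> nat set" where
  "zeros u \<equiv> {n. u n = 0}"

definition staircase_word :: "word \<Rightarrow> bool" where
  "staircase_word u \<longleftrightarrow> u 0 = 0 \<and> (\<forall>n. u (Suc n) = 0 \<or> u (Suc n) = Suc (u n))"

lemma staircase_word_diff:
  assumes "staircase_word u" "v \<le> u n"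
  shows "v \<le> n \<and> u (n - v) = u n - v"
  using assms(2)
proof (induction n arbitrary: v)
  case 0
  then show ?case using assms(1) by (simp add: staircase_word_def)
next
  case (Suc n)
  show ?case
  proof (cases v)
    case (Suc v')
    then have "u (Suc n) \<noteq> 0" using Suc.prems by simp
    then have "u (Suc n) = Suc (u n)" using assms(1) unfolding staircase_word_def by metis
    then show ?thesis using Suc Suc.IH[of v'] Suc.prems by simp
  qed simp
qed

lemma fergusonian_le: "fergusonian k u \<Longrightarrow> u n \<le> k"
  unfolding fergusonian_def by (metis atLeastAtMost_iff rangeI subsetD)

lemma fergusonian_Suc_iff:
  assumes "fergusonian k u" "i < k - 1"
  shows "u (Suc n) = Suc i \<longleftrightarrow> u n = i"
  using assms unfolding fergusonian_def by (metis Suc_eq_plus1 diff_Suc_1)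

lemma strongly_fergusonian_imp_staircase_word:
  assumes "strongly_fergusonian k u" "u 0 = 0"
  shows "staircase_word u"
proof -
  have ferg: "fergusonian k u" and max: "u n = k \<Longrightarrow> u (Suc n) \<noteq> k" for n
    using assms(1) by (auto simp: strongly_fergusonian_def)
  have "u (Suc n) = Suc (u n)" if pos: "u (Suc n) \<noteq> 0" for n
  proof (cases "u (Suc n) = k")
    case True
    then have "u n \<noteq> k" "\<not> u n < k - 1"
      using max[of n] fergusonian_Suc_iff[OF ferg, of "u n" n] by auto
    then show ?thesis using True fergusonian_le[OF ferg, of n] pos by linarith
  next
    case False
    then have "u (Suc n) - 1 < k - 1" "u (Suc n) = Suc (u (Suc n) - 1)"
      using fergusonian_le[OF ferg, of "Suc n"] pos by linarith+
    then show ?thesis using fergusonian_Suc_iff[OF ferg] by metis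
  qed
  then show ?thesis using assms(2) by (auto simp: staircase_word_def)
qed

lemma omega_power_factor: "0 < p \<Longrightarrow> omega_power (factor u 0 p) n = u (n mod p)"
  by (simp add: omega_power_def factor_def)

lemma staircase_word_omega_power:
  assumes "staircase_word u" "0 < p"
  shows "staircase_word (omega_power (factor u 0 p))"
  using assms by (auto simp: staircase_word_def omega_power_factor mod_Suc)

lemma zeros_omega_power_separated:
  assumes "0 < p" "S \<subseteq> {..<p}"
    and separated: "(zeros u + S) \<inter> zeros u = {}"
    and border: "\<And>b s. b \<in> zeros u \<Longrightarrow> b < p \<Longrightarrow> s \<in> S \<Longrightarrow> b + p - s \<notin> zeros u"
  defines "v \<equiv> omega_power (factor u 0 p)"
  shows "(zeros v + S) \<inter> zeros v = {}"
proof -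
  have "u ((n + s) mod p) \<noteq> 0" if s: "s \<in> S" and zero: "u (n mod p) = 0" for n s
  proof (cases "n mod p + s < p")
    case True
    then have "(n + s) mod p = n mod p + s" using mod_add_left_eq[of n p s] by simp
    moreover have "n mod p + s \<notin> zeros u"
      using separated s zero by (simp add: set_plus_Int_empty_iff)
    ultimately show ?thesis by simp
  next
    case False
    let ?b = "n mod p + s - p"
    have "n mod p < p" "s < p" using assms(1,2) s by auto
    then have b: "?b < p" "?b + p - s = n mod p" using False by linarith+
    have "(n + s) mod p = ?b"
      using mod_add_left_eq[of n p s] le_mod_geq[of p "n mod p + s"] False b(1) by simp
    moreover have "?b \<notin> zeros u" using border[of ?b s] b s zero by auto
    ultimately show ?thesis by simp
  qed
  then show ?thesis
    using assms(1) by (simp add: v_def omega_power_factor set_plus_Int_empty_iff)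
qed

section \<open>Representation words\<close>

lemma representation_word_0:
  assumes "representing_sequence a"
  shows "representation_word a 0 = 0"
proof -
  have "\<not> m_volatile a 2 0"
    using volatile_if_m_volatile[of a 2 0] last_representation_1[OF assms]
    by (auto simp: volatile_iff)
  then show ?thesis by (simp add: representation_word_def last_representation_0)
qed

lemma staircase_word_representation_word:
  assumes "representing_sequence a" "strongly_fergusonian k (representation_word a)"
  shows "staircase_word (representation_word a)"
  using strongly_fergusonian_imp_staircase_word[OF assms(2) representation_word_0[OF assms(1)]] .

lemma zeros_representation_word:
  assumes "fergusonian (a 1) (representation_word a)"
  shows "zeros (representation_word a) = nonvolatile_zends a"
proof (intro set_eqI iffI)
  have a1: "2 \<le> a 1" using assms by (simp add: fergusonian_def)
  fix n assume "n \<in> zeros (representation_word a)"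
  moreover from this have "representation_word a (n + 1) = 1"
    using fergusonian_Suc_iff[OF assms, of 0 n] a1 by simp
  ultimately show "n \<in> nonvolatile_zends a"
    using a1 by (auto simp: representation_word_def nonvolatile_zends_iff split: if_splits)
next
  fix n assume "n \<in> nonvolatile_zends a"
  then show "n \<in> zeros (representation_word a)"
    using volatile_if_m_volatile[of a 2 n]
    by (auto simp: representation_word_def nonvolatile_zends_def zend_iff)
qed

lemma representation_word_eq_max_iff:
  assumes "representing_sequence a"
  shows "representation_word a n = a 1 \<longleftrightarrow> m_volatile a 2 n"
  using last_representation_less[OF assms, of n] by (auto simp: representation_word_def)

section \<open>Nim sequences\<close>

definition reaches_smaller_letters :: "word \<Rightarrow> nat set \<Rightarrow> bool" where
  "reaches_smaller_letters u S \<longleftrightarrow> (\<forall>n. \<forall>v<u n. \<exists>s\<in>S. s \<le> n \<and> u (n - s) = v)"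

lemma mex_eqI:
  assumes "m \<notin> A" "\<And>v. v < m \<Longrightarrow> v \<in> A"
  shows "mex A = m"
  unfolding mex_def by (rule Least_equality) (use assms not_less in blast)+

lemma is_nim_sequenceI:
  assumes reaches: "reaches_smaller_letters u S"
    and distinct: "\<And>n s. s \<in> S \<Longrightarrow> u (n + s) \<noteq> u n"
  shows "is_nim_sequence u S"
  unfolding is_nim_sequence_def
proof
  fix n
  show "u n = SG S n"
  proof (induction n rule: less_induct)
    case (less n)
    let ?M = "{s \<in> S. 0 < s \<and> s \<le> n}"
    have pos: "0 < s" if "s \<in> S" for s
      using distinct[OF that, of 0] by (cases s) simp_all
    have "mex ((\<lambda>s. u (n - s)) ` ?M) = u n"
    proof (rule mex_eqI)
      show "u n \<notin> (\<lambda>s. u (n - s)) ` ?M"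
      proof
        assume "u n \<in> (\<lambda>s. u (n - s)) ` ?M"
        then obtain s where "s \<in> S" "s \<le> n" "u n = u (n - s)" by auto
        then show False using distinct[of s "n - s"] by simp
      qed
      show "v \<in> (\<lambda>s. u (n - s)) ` ?M" if "v < u n" for v
        using reaches that pos unfolding reaches_smaller_letters_def by blast
    qed
    moreover have "(\<lambda>s. SG S (n - s)) ` ?M = (\<lambda>s. u (n - s)) ` ?M"
      by (rule image_cong) (use less.IH in auto)
    ultimately show ?case by (subst SG.simps) simp
  qed
qed

lemma is_nim_sequence_staircase_word:
  assumes "staircase_word u" "reaches_smaller_letters u S"
    and separated: "(zeros u + S) \<inter> zeros u = {}"
  shows "is_nim_sequence u S"
proof (rule is_nim_sequenceI[OF assms(2)], rule notI)
  fix n s assume s: "s \<in> S" and eq: "u (n + s) = u n"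
  have n: "u n \<le> n" "u (n - u n) = 0" "u (n + s - u n) = 0"
    using staircase_word_diff[OF assms(1), of "u n"] eq by simp_all
  then have "n - u n \<in> zeros u" "n - u n + s \<in> zeros u" by simp_all
  then show False using separated s unfolding set_plus_Int_empty_iff by blast
qed

lemma staircase_word_reaches_smaller_letters:
  assumes "staircase_word u" "\<And>n. u n \<le> k" "{1..k - 1} \<subseteq> S"
    and zero: "\<And>n. u n = k \<Longrightarrow> \<exists>s\<in>S. s \<le> n \<and> u (n - s) = 0"
  shows "reaches_smaller_letters u S"
  unfolding reaches_smaller_letters_def
proof (intro allI impI)
  fix n v assume v: "v < u n"
  show "\<exists>s\<in>S. s \<le> n \<and> u (n - s) = v"
  proof (cases "v = 0 \<and> u n = k")
    case False
    then have "u n - v \<in> {1..k - 1}" using v assms(2)[of n] by auto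
    then have "u n - v \<in> S" using assms(3) by blast
    moreover have "u n - v \<le> n" "u (n - (u n - v)) = v"
      using staircase_word_diff[OF assms(1), of "u n - v" n] v by simp_all
    ultimately show ?thesis by blast
  qed (use zero in blast)
qed

lemma reaches_smaller_letters_omega_power:
  assumes "reaches_smaller_letters u S" "0 < p"
  shows "reaches_smaller_letters (omega_power (factor u 0 p)) {s \<in> S. s < p}"
  unfolding reaches_smaller_letters_def omega_power_factor[OF assms(2)]
proof (intro allI impI)
  fix n v assume "v < u (n mod p)"
  then obtain s where s: "s \<in> S" "s \<le> n mod p" "u (n mod p - s) = v"
    using assms(1) unfolding reaches_smaller_letters_def by blast
  moreover have "s < p" using s(2) assms(2) by (simp add: le_less_trans)
  moreover have "s \<le> n" using s(2) by (rule order_trans) simp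
  ultimately show "\<exists>s\<in>{s \<in> S. s < p}. s \<le> n \<and> u ((n - s) mod p) = v"
    using diff_mod_eq[OF s(2)] by auto
qed

lemma is_nim_sequence_omega_power:
  assumes "staircase_word u" "reaches_smaller_letters u S" "0 < p"
    and separated: "(zeros u + S) \<inter> zeros u = {}"
    and border: "\<And>b s. b \<in> zeros u \<Longrightarrow> b < p \<Longrightarrow> s \<in> S \<Longrightarrow> s < p \<Longrightarrow> b + p - s \<notin> zeros u"
  shows "is_nim_sequence (omega_power (factor u 0 p)) {s \<in> S. s < p}"
proof (rule is_nim_sequence_staircase_word)
  let ?u = "omega_power (factor u 0 p)"
  have "(zeros u + {s \<in> S. s < p}) \<inter> zeros u = {}"
    using separated by (simp add: set_plus_Int_empty_iff)
  then show "(zeros ?u + {s \<in> S. s < p}) \<inter> zeros ?u = {}"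
    by (rule zeros_omega_power_separated[OF assms(3), rotated]) (use border in auto)
qed (use assms in \<open>simp_all add: staircase_word_omega_power reaches_smaller_letters_omega_power\<close>)

lemma representation_word_reaches_smaller_letters:
  assumes "representing_sequence a" "strongly_fergusonian (a 1) (representation_word a)"
    and "{a i - 1 | i. i \<ge> 2} \<union> {1..a 1 - 1} \<subseteq> S"
  shows "reaches_smaller_letters (representation_word a) S"
proof (rule staircase_word_reaches_smaller_letters)
  let ?w = "representation_word a"
  have ferg: "fergusonian (a 1) ?w" using assms(2) by (simp add: strongly_fergusonian_def)
  show "staircase_word ?w" by (rule staircase_word_representation_word[OF assms(1,2)])
  show "?w n \<le> a 1" for n using ferg by (rule fergusonian_le)
  show "\<exists>s\<in>S. s \<le> n \<and> ?w (n - s) = 0" if "?w n = a 1" for n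
  proof -
    have "m_volatile a 2 n" using that representation_word_eq_max_iff[OF assms(1)] by blast
    then obtain i where "2 \<le> i" "a i - 1 \<le> n" "n - (a i - 1) \<in> zeros ?w"
      using m_volatile_minus_term[OF assms(1), of 2 n] zeros_representation_word[OF ferg] by auto
    moreover from this have "a i - 1 \<in> S" using assms(3) by blast
    ultimately show ?thesis by auto
  qed
qed (use assms(3) in simp)

theorem theorem4p11:
  fixes a :: "nat \<Rightarrow> nat" and k :: nat and w :: word and T N L I :: "nat set"
  assumes "representing_sequence a"
    and "a 1 = k"
    and "w = representation_word a"
    and "strongly_fergusonian k w"
    and "T = {a i - 1 | i. i \<ge> 2} \<union> {1..k - 1}"
    and "N = {n. zend a n \<and> \<not> volatile a n}"
    and "L = UNIV - N"
    and "\<forall>s \<in> I. 0 < s"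
    and "T \<subseteq> I"
    and "(N + I) \<inter> N = {}"
  shows "(\<forall>S. T \<subseteq> S \<and> S \<subseteq> I \<longrightarrow> is_nim_sequence w S) \<and>
    (\<forall>S i. T \<subseteq> S \<and> S \<subseteq> I \<longrightarrow>
       (\<forall>b \<in> N. b < a i \<longrightarrow> {b + a i - s | s. s \<in> {s \<in> S. s < a i}} \<subseteq> L) \<longrightarrow>
       is_nim_sequence (omega_power (factor w 0 (a i))) {s \<in> S. s < a i})"
proof -
  have N: "N = zeros w"
    using assms(2-4,6) zeros_representation_word
    by (auto simp: nonvolatile_zends_def strongly_fergusonian_def)
  have staircase: "staircase_word w"
    using staircase_word_representation_word[OF assms(1)] assms(3,4) by simp
  have reaches: "reaches_smaller_letters w S" if "T \<subseteq> S" for S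
    using representation_word_reaches_smaller_letters[OF assms(1)] assms(2-5) that by simp
  have separated: "(zeros w + S) \<inter> zeros w = {}" if "S \<subseteq> I" for S
    using assms(10) set_plus_mono2[OF subset_refl that] unfolding N by blast
  have pos: "0 < a i" for i using assms(1) by (simp add: representing_sequence_def)
  have "is_nim_sequence w S" if "T \<subseteq> S" "S \<subseteq> I" for S
    using is_nim_sequence_staircase_word[OF staircase reaches separated] that .
  moreover have "is_nim_sequence (omega_power (factor w 0 (a i))) {s \<in> S. s < a i}"
    if "T \<subseteq> S" "S \<subseteq> I"
      and border: "\<forall>b \<in> N. b < a i \<longrightarrow> {b + a i - s | s. s \<in> {s \<in> S. s < a i}} \<subseteq> L" for S i
  proof (rule is_nim_sequence_omega_power[OF staircase reaches pos separated])
    show "b + a i - s \<notin> zeros w" if "b \<in> zeros w" "b < a i" "s \<in> S" "s < a i" for b s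
      using border that assms(7) unfolding N by blast
  qed (use that in simp_all)
  ultimately show ?thesis by blast
qed

end
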